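(* For every integer $k\ge 1$, every twist torus $\Theta^k\subset\mathbb{C}^{k+1}$ is displaceable in $\mathbb{C}^{k+1}$.
   Context: $\mathbb{C}^{k+1}=\mathbb{R}^{2k+2}$ carries its standard symplectic form $\omega=\sum_j dx_j\wedge dy_j$. Twist torus (Chekanov--Schlenk): consider the open sector $\mathcal{S}(k)=\{re^{i\phi}: r>0,\ 0<\phi<\frac{2\pi}{k+1}\}\subset\mathbb{C}$ and the open disc $D^2(k+1+\epsilon)\subset\mathbb{C}$ of area $k+1+\epsilon$ centered at the origin, where $\epsilon>0$. Let $\gamma$ be a smooth embedded closed curve in $\mathcal{S}(k)\cap D^2(k+1+\epsilon)$ enclosing a domain of area $1$. The associated twist torus is $$\Theta^k=\left\{\tfrac{1}{\sqrt{k+1}}\left(e^{i\alpha_1}w,\dots,e^{i\alpha_{k+1}}w\right) : w\in\gamma,\ \alpha_1,\dots,\alpha_{k+1}\in\mathbb{R},\ \sum_{j=1}^{k+1}\alpha_j=0\right\}\subset\mathbb{C}^{k+1}.$$ A subset $L\subset\mathbb{C}^{k+1}$ is displaceable if there is a Hamiltonian isotopy $\{\phi_t\}_{t\in[0,1]}$ of $\mathbb{C}^{k+1}$ with $\phi_0=\mathrm{id}$ and $\phi_1(L)\cap L=\emptyset$. *)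

theory Defs
  imports "HOL-Analysis.Analysis"
begin

text \<open>Over a finite-dimensional domain, iterating continuity of all directional derivatives
  is the usual \<open>C\<^sup>n\<close> condition.\<close>

primrec Cn_on :: "nat \<Rightarrow> 'a::euclidean_space set \<Rightarrow> ('a \<Rightarrow> 'b::real_normed_vector) \<Rightarrow> bool" where
  "Cn_on 0 U f \<longleftrightarrow> continuous_on U f"
| "Cn_on (Suc n) U f \<longleftrightarrow> (\<forall>x\<in>U. f differentiable (at x)) \<and>
     (\<forall>v. Cn_on n U (\<lambda>x. frechet_derivative f (at x) v))"

text \<open>Smoothness on a set that need not be open, such as \<open>[0,1] \<times> \<complex>\<^sup>n\<close>: existence of a
  smooth extension to an open neighbourhood.\<close>

definition smooth_on :: "'a::euclidean_space set \<Rightarrow> ('a \<Rightarrow> 'b::real_normed_vector) \<Rightarrow> bool" where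
  "smooth_on S f \<longleftrightarrow>
     (\<exists>U g. open U \<and> S \<subseteq> U \<and> (\<forall>n. Cn_on n U g) \<and> (\<forall>x\<in>S. g x = f x))"

definition diffeomorphism :: "('a::euclidean_space \<Rightarrow> 'a) \<Rightarrow> bool" where
  "diffeomorphism f \<longleftrightarrow> bij f \<and> smooth_on UNIV f \<and> smooth_on UNIV (inv f)"

definition std_symplectic :: "complex ^ 'n \<Rightarrow> complex ^ 'n \<Rightarrow> real" where
  "std_symplectic v w = (\<Sum>j\<in>UNIV. Re (v $ j) * Im (w $ j) - Im (v $ j) * Re (w $ j))"

text \<open>The time-dependent vector field \<open>X\<close> of \<open>H\<close> is given by \<open>\<omega>(X, \<cdot>) = dH\<close>; the opposite
  sign convention yields the same isotopies, via \<open>-H\<close>.\<close>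

definition hamiltonian_isotopy :: "(real \<Rightarrow> complex ^ 'n \<Rightarrow> complex ^ 'n) \<Rightarrow> bool" where
  "hamiltonian_isotopy \<phi> \<longleftrightarrow>
     smooth_on ({0..1} \<times> UNIV) (\<lambda>(t, x). \<phi> t x) \<and>
     (\<forall>t\<in>{0..1}. diffeomorphism (\<phi> t)) \<and>
     \<phi> 0 = id \<and>
     (\<exists>H :: real \<Rightarrow> complex ^ 'n \<Rightarrow> real.
        smooth_on ({0..1} \<times> UNIV) (\<lambda>(t, x). H t x) \<and>
        (\<forall>t\<in>{0..1}. \<forall>x. \<exists>X.
           ((\<lambda>s. \<phi> s x) has_vector_derivative X) (at t within {0..1}) \<and>
           (H t has_derivative std_symplectic X) (at (\<phi> t x))))"

definition displaceable :: "(complex ^ 'n) set \<Rightarrow> bool" where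
  "displaceable L \<longleftrightarrow> (\<exists>\<phi>. hamiltonian_isotopy \<phi> \<and> \<phi> 1 ` L \<inter> L = {})"

text \<open>A curve is a subset of the plane: the image of a smooth embedding of
  the circle \<open>\<real>/\<int>\<close>.\<close>

definition smooth_embedded_closed_curve :: "complex set \<Rightarrow> bool" where
  "smooth_embedded_closed_curve \<gamma> \<longleftrightarrow>
     (\<exists>c :: real \<Rightarrow> complex.
        smooth_on UNIV c \<and> (\<forall>t. c (t + 1) = c t) \<and> inj_on c {0..<1} \<and>
        (\<forall>t. vector_derivative c (at t) \<noteq> 0) \<and> \<gamma> = range c)"

definition sector :: "nat \<Rightarrow> complex set" where
  "sector k = {of_real r * cis \<theta> | r \<theta>. 0 < r \<and> 0 < \<theta> \<and> \<theta> < 2 * pi / real (k + 1)}"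

definition disc_of_area :: "real \<Rightarrow> complex set" where
  "disc_of_area a = ball 0 (sqrt (a / pi))"

text \<open>Meaningful for \<open>CARD('n) = k + 1\<close>.\<close>

definition twist_torus :: "nat \<Rightarrow> complex set \<Rightarrow> (complex ^ 'n) set" where
  "twist_torus k \<gamma> =
     {\<chi> j. of_real (1 / sqrt (real (k + 1))) * (cis (\<alpha> j) * w) | (\<alpha> :: 'n \<Rightarrow> real) w.
        w \<in> \<gamma> \<and> (\<Sum>j\<in>UNIV. \<alpha> j) = 0}"

end

theory Submission
  imports Defs
begin

text \<open>Translation by a vector \<open>v\<close> is the time-one map of the flow of the linear, time-independent
  (not compactly supported) Hamiltonian \<open>\<omega>(v, \<cdot>)\<close>. A translation longer than the diameter of a
  bounded set displaces it, and twist tori are bounded.\<close>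

text \<open>The derivative of a constant is the constant 0, so the induction has to let
  \<open>c\<close> vary.\<close>

lemma Cn_on_const: "Cn_on n U (\<lambda>x. c)"
proof (induction n arbitrary: c)
  case (Suc n)
  have "frechet_derivative (\<lambda>x. c) (at x) v = 0" for x v :: 'a
    using frechet_derivative_at[OF has_derivative_const[of c]] by (simp add: fun_eq_iff)
  then show ?case using Suc by simp
qed simp

text \<open>In each fixed direction \<open>v\<close> the derivative of an affine map is the constant
  \<open>f v\<close>, so all orders above the first reduce to \<open>Cn_on_const\<close> and a case
  split on \<open>n\<close> suffices.\<close>

lemma Cn_on_bounded_linear_add_const:
  assumes "bounded_linear f"
  shows "Cn_on n U (\<lambda>x. f x + c)"
proof (cases n)
  case 0
  then show ?thesis
    by (auto intro!: continuous_intros bounded_linear.continuous_on[OF assms])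
next
  case (Suc m)
  have der: "((\<lambda>x. f x + c) has_derivative f) (at x)" for x
    by (auto intro!: derivative_eq_intros bounded_linear_imp_has_derivative assms)
  have "frechet_derivative (\<lambda>x. f x + c) (at x) v = f v" for x v
    using frechet_derivative_at[OF der] by (simp add: fun_eq_iff)
  moreover have "(\<lambda>x. f x + c) differentiable (at x)" for x
    using der unfolding differentiable_def by blast
  ultimately show ?thesis
    using Suc by (simp add: Cn_on_const)
qed

lemma smooth_on_bounded_linear_add_const:
  "bounded_linear f \<Longrightarrow> smooth_on S (\<lambda>x. f x + c)"
  unfolding smooth_on_def using Cn_on_bounded_linear_add_const by blast

lemma smooth_on_bounded_linear: "bounded_linear f \<Longrightarrow> smooth_on S f"
  using smooth_on_bounded_linear_add_const[of f S 0] by simp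

lemma diffeomorphism_translation: "diffeomorphism (\<lambda>x. x + v)"
proof -
  have "inv (\<lambda>x. x + v) = (\<lambda>x. x + - v)"
    by (rule inv_equality) auto
  then show ?thesis
    unfolding diffeomorphism_def
    \<comment> \<open>Without \<open>add_uminus_conv_diff\<close> the inverse keeps the form
      \<open>x + - v\<close>, an instance of the affine lemma.\<close>
    by (simp add: bij_plus_right smooth_on_bounded_linear_add_const[OF bounded_linear_ident]
        del: add_uminus_conv_diff)
qed

lemma bounded_linear_std_symplectic: "bounded_linear (std_symplectic v)"
  unfolding std_symplectic_def
  by (intro bounded_linear_sum bounded_linear_sub bounded_linear_const_mult
      bounded_linear_compose[OF bounded_linear_Re] bounded_linear_compose[OF bounded_linear_Im]
      bounded_linear_vec_nth)

lemma hamiltonian_isotopy_translation: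
  "hamiltonian_isotopy (\<lambda>t x. x + t *\<^sub>R v)"
proof -
  \<comment> \<open>The map is linear in the pair of time and point jointly, so it serves as its own
    smooth extension beyond the time interval.\<close>
  have "smooth_on ({0..1} \<times> UNIV) (\<lambda>p. snd p + fst p *\<^sub>R v)"
    by (intro smooth_on_bounded_linear bounded_linear_add bounded_linear_snd
        bounded_linear_scaleR_const bounded_linear_fst)
  then have 1: "smooth_on ({0..1} \<times> UNIV) (\<lambda>(t, x). x + t *\<^sub>R v)"
    by (simp add: case_prod_unfold)
  have "smooth_on ({0..1::real} \<times> UNIV) (\<lambda>p. std_symplectic v (snd p))"
    by (intro smooth_on_bounded_linear
        bounded_linear_compose[OF bounded_linear_std_symplectic] bounded_linear_snd)
  then have 2: "smooth_on ({0..1::real} \<times> UNIV) (\<lambda>(t, x). std_symplectic v x)"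
    by (simp add: case_prod_unfold)
  have 3: "((\<lambda>s. x + s *\<^sub>R v) has_vector_derivative v) (at t within {0..1})" for x t
    by (auto intro!: derivative_eq_intros simp: has_vector_derivative_def)
  \<comment> \<open>A linear function is its own derivative everywhere, so the constant field
    \<open>v\<close> satisfies the Hamiltonian equation at every point and time.\<close>
  have 4: "(std_symplectic v has_derivative std_symplectic v) (at y)" for y
    by (rule bounded_linear_imp_has_derivative[OF bounded_linear_std_symplectic])
  show ?thesis
    unfolding hamiltonian_isotopy_def
    using 1 diffeomorphism_translation
    by (auto intro!: exI[of _ "\<lambda>_. std_symplectic v"] exI[of _ v] 2 3 4)
qed

lemma displaceable_if_bounded:
  assumes "bounded L"
  shows "displaceable L"
proof -
  obtain B where B: "B > 0" "\<And>x. x \<in> L \<Longrightarrow> norm x \<le> B"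
    using assms bounded_pos by blast
  obtain v :: "complex ^ 'a" where v: "norm v = 2 * B + 1"
    using vector_choose_size[of "2 * B + 1"] B(1) by auto
  \<comment> \<open>Otherwise \<open>v\<close>, as the difference of two points of norm at most
    \<open>B\<close>, would have norm at most \<open>2 * B\<close>.\<close>
  have "x + v \<notin> L" if "x \<in> L" for x
    using B(2)[OF that] B(2)[of "x + v"] v norm_triangle_ineq4[of "x + v" x] by auto
  then have "(\<lambda>x. x + 1 *\<^sub>R v) ` L \<inter> L = {}"
    by auto
  then show ?thesis
    unfolding displaceable_def using hamiltonian_isotopy_translation[of v] by blast
qed

text \<open>The factors \<open>cis (\<alpha> j)\<close> have modulus 1, so every coordinate has
  modulus \<open>norm w / sqrt (k + 1)\<close>. The sum of these moduli bounds the Euclidean norm,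
  uniformly in the angles.\<close>

lemma bounded_twist_torus:
  assumes "bounded \<gamma>"
  shows "bounded (twist_torus k \<gamma> :: (complex ^ 'n) set)"
proof -
  obtain B where B: "\<And>w. w \<in> \<gamma> \<Longrightarrow> norm w \<le> B"
    using assms bounded_iff by blast
  have "norm x \<le> (\<Sum>j\<in>(UNIV :: 'n set). 1 / sqrt (real (k + 1)) * B)"
    if xL: "x \<in> twist_torus k \<gamma>" for x :: "complex ^ 'n"
  proof -
    obtain \<alpha> w where w: "w \<in> \<gamma>"
      and x: "x = (\<chi> j. of_real (1 / sqrt (real (k + 1))) * (cis (\<alpha> j) * w))"
      using xL unfolding twist_torus_def by blast
    have "norm (x $ j) \<le> 1 / sqrt (real (k + 1)) * B" for j
      using B[OF w] by (simp add: x norm_mult norm_divide divide_right_mono)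
    then show ?thesis
      unfolding norm_vec_def
      by (intro order_trans[OF L2_set_le_sum] sum_mono) auto
  qed
  then show ?thesis
    using bounded_iff by blast
qed

theorem corollary2p1:
  fixes k :: nat and \<epsilon> :: real and \<gamma> :: "complex set"
  assumes "k \<ge> 1"
    and "CARD('n) = k + 1"
    and "\<epsilon> > 0"
    and "smooth_embedded_closed_curve \<gamma>"
    and "\<gamma> \<subseteq> sector k \<inter> disc_of_area (real (k + 1) + \<epsilon>)"
    and "measure lebesgue (inside \<gamma>) = 1"
  shows "displaceable (twist_torus k \<gamma> :: (complex ^ 'n) set)"
proof -
  \<comment> \<open>The curve lies in a disc of finite area.\<close>
  have "bounded \<gamma>"
    using assms(5) bounded_subset[OF bounded_ball] unfolding disc_of_area_def by blast
  then show ?thesis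
    by (intro displaceable_if_bounded bounded_twist_torus)
qed

end
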